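(* Consider the consecutive sequential probability ratio test (CSPRT) for the simple hypotheses $\mathscr{H}_i:\theta=\theta_i$, $i=0,1,\ldots,m-1$, described in the context. If the sampling process will eventually terminate according to the stopping rule with probability $1$, then $\Pr\{\text{Reject }\mathscr{H}_i\mid\theta_i\}\le\alpha_{i+1}+\beta_i$ for $0\le i\le m-1$. Moreover, the sampling process will eventually terminate according to the stopping rule with probability $1$, provided that the likelihood function $f_n(\boldsymbol{\mathcal{X}}_n;\theta)$ is unimodal with respect to $\theta\in\Theta$ for any $n$, and that for arbitrary $\alpha,\beta\in(0,1)$ and $\theta\in\Theta$, $$\Pr\left\{\beta<\Upsilon_n(\boldsymbol{\mathcal{X}}_n;\theta_{i-1},\theta_i)<\tfrac1\alpha\;\Big|\;\theta\right\}\to0,\qquad i=1,\ldots,m-1,$$ as the sample number $n$ tends to $N^*$.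
   Context: Process. $\mathcal{N}$ is a set of positive integers (possibly finite); $N^*=\infty$ if $\mathcal{N}$ is unbounded and $N^*=\max\mathcal{N}$ otherwise (when $N^*$ is finite, a limit as $n\to N^*$ is understood as the value at $n=N^*$). $(X_n)_{n\in\mathcal{N}}$ is a discrete-time process parameterized by $\theta\in\Theta\subseteq\mathbb{R}$; $\Pr\{E\mid\theta\}$ is the probability of $E$ associated with parameter $\theta$. Write $\boldsymbol{\mathcal{X}}_n=(X_1,\ldots,X_n)$, let $f_n(\cdot;\theta)$ be its joint PDF or PMF under $\theta$; $f_n(\boldsymbol{\mathcal{X}}_n;\theta)$ is the likelihood function. Likelihood ratio notation. For $\theta',\theta''\in\Theta$, $\kappa>0$ and a relation $\sim$ among $<,=,>,\le,\ge$, "$\Upsilon_n(\boldsymbol{\mathcal{X}}_n;\theta',\theta'')\sim\kappa$" means $f_n(\boldsymbol{\mathcal{X}}_n;\theta'')\sim\kappa f_n(\boldsymbol{\mathcal{X}}_n;\theta')$. Unimodality. A function is unimodal with respect to $\theta\in\Theta$ if there is a number $\theta^*$ such that it is non-decreasing in $\theta\in\Theta$ no greater than $\theta^*$ and non-increasing in $\theta\in\Theta$ no less than $\theta^*$. Hypotheses and test. $m\ge2$; $\theta_0<\theta_1<\cdots<\theta_{m-1}$ are elements of $\Theta$. Fix $\alpha_i,\beta_i\in(0,1)$ for $i=1,\ldots,m-1$ and set $\alpha_m=\beta_0=0$. Continue the sampling process (over $n\in\mathcal{N}$ in increasing order) until there exists an index $j\in\{0,1,\ldots,m-1\}$ such that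 $\Upsilon_n(\boldsymbol{\mathcal{X}}_n;\theta_{i-1},\theta_i)\ge\frac1{\alpha_i}$ for $0<i\le j$ and $\Upsilon_n(\boldsymbol{\mathcal{X}}_n;\theta_{i-1},\theta_i)\le\beta_i$ for $j<i<m$. At the termination of the sampling process, accept $\mathscr{H}_j$ with the index $j$ satisfying the stopping condition (if several indices satisfy it, one is picked by a predetermined policy); the other hypotheses are rejected. "The sampling process will eventually terminate according to the stopping rule" means that the stopping condition is satisfied for some $n\in\mathcal{N}$; "with probability $1$" means under every $\theta\in\Theta$. *)

theory Defs
  imports "HOL-Probability.Probability"
begin

definition obs :: "(nat \<Rightarrow> 'w \<Rightarrow> 'a) \<Rightarrow> nat \<Rightarrow> 'w \<Rightarrow> (nat \<Rightarrow> 'a)" where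
  "obs X n \<omega> = (\<lambda>k\<in>{1..n}. X k \<omega>)"

definition joint_pdf ::
  "'w measure \<Rightarrow> (nat \<Rightarrow> 'w \<Rightarrow> 'a::euclidean_space) \<Rightarrow> nat \<Rightarrow> ((nat \<Rightarrow> 'a) \<Rightarrow> real) \<Rightarrow> bool" where
  "joint_pdf Q X n g \<longleftrightarrow>
     (\<forall>x\<in>{1..n} \<rightarrow>\<^sub>E UNIV. 0 \<le> g x) \<and>
     distributed Q (Pi\<^sub>M {1..n} (\<lambda>_. lborel)) (obs X n) (\<lambda>x. ennreal (g x))"

definition joint_pmf ::
  "'w measure \<Rightarrow> (nat \<Rightarrow> 'w \<Rightarrow> 'a::euclidean_space) \<Rightarrow> nat \<Rightarrow> ((nat \<Rightarrow> 'a) \<Rightarrow> real) \<Rightarrow> bool" where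
  "joint_pmf Q X n g \<longleftrightarrow>
     (\<exists>S. countable S \<and> (AE \<omega> in Q. obs X n \<omega> \<in> S)) \<and>
     (\<forall>x\<in>{1..n} \<rightarrow>\<^sub>E UNIV. g x = \<P>(\<omega> in Q. obs X n \<omega> = x))"

text \<open>
  For a fixed sample size the joint laws under all parameters are of the same kind:
  either all are given by densities, or all are discrete.
  Only the variables \<open>X k\<close> with \<open>1 \<le> k \<le> n\<close> for some \<open>n \<in> N\<close> matter.
\<close>

locale parametric_process =
  fixes M :: "'w measure"
    and P :: "real \<Rightarrow> 'w measure"
    and \<Theta> :: "real set"
    and N :: "nat set"
    and X :: "nat \<Rightarrow> 'w \<Rightarrow> 'a::euclidean_space"
    and f :: "nat \<Rightarrow> (nat \<Rightarrow> 'a) \<Rightarrow> real \<Rightarrow> real"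
  assumes N_nonempty: "N \<noteq> {}"
    and N_pos: "\<And>n. n \<in> N \<Longrightarrow> 0 < n"
    and prob_space_P: "\<And>t. t \<in> \<Theta> \<Longrightarrow> prob_space (P t)"
    and sets_P: "\<And>t. t \<in> \<Theta> \<Longrightarrow> sets (P t) = sets M"
    and X_measurable: "\<And>n k. n \<in> N \<Longrightarrow> k \<in> {1..n} \<Longrightarrow> X k \<in> borel_measurable M"
    and joint_law: "\<And>n. n \<in> N \<Longrightarrow>
      (\<forall>t\<in>\<Theta>. joint_pdf (P t) X n (\<lambda>x. f n x t)) \<or>
      (\<forall>t\<in>\<Theta>. joint_pmf (P t) X n (\<lambda>x. f n x t))"

text \<open>
  \<open>LR rel L t' t'' \<kappa>\<close> renders the comparison of the likelihood ratio \<open>L t'' / L t'\<close> with \<open>\<kappa>\<close>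
  in the division-free form that also makes sense when \<open>L t' = 0\<close>.
\<close>

definition LR ::
  "(real \<Rightarrow> real \<Rightarrow> bool) \<Rightarrow> (real \<Rightarrow> real) \<Rightarrow> real \<Rightarrow> real \<Rightarrow> real \<Rightarrow> bool" where
  "LR rel L t' t'' \<kappa> \<longleftrightarrow> rel (L t'') (\<kappa> * L t')"

text \<open>The mode \<open>c\<close> is any real number; it need not belong to \<open>S\<close>.\<close>

definition unimodal_on :: "real set \<Rightarrow> (real \<Rightarrow> real) \<Rightarrow> bool" where
  "unimodal_on S g \<longleftrightarrow> (\<exists>c. mono_on (S \<inter> {..c}) g \<and> antimono_on (S \<inter> {c..}) g)"

text \<open>
  Limit of \<open>g n\<close> as \<open>n\<close> runs through \<open>N\<close> towards its supremum; for finite \<open>N\<close> this is the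
  value at the largest element.
\<close>

definition tends_along :: "nat set \<Rightarrow> (nat \<Rightarrow> real) \<Rightarrow> real \<Rightarrow> bool" where
  "tends_along N g l \<longleftrightarrow>
     (if finite N then g (Max N) = l else (g \<longlongrightarrow> l) (inf sequentially (principal N)))"

text \<open>In the following, \<open>L\<close> is the likelihood function of the observed sample.\<close>

definition csprt_index ::
  "nat \<Rightarrow> (nat \<Rightarrow> real) \<Rightarrow> (nat \<Rightarrow> real) \<Rightarrow> (nat \<Rightarrow> real) \<Rightarrow> (real \<Rightarrow> real) \<Rightarrow> nat \<Rightarrow> bool" where
  "csprt_index m \<theta> \<alpha> \<beta> L j \<longleftrightarrow>
     j < m \<and>
     (\<forall>i. 0 < i \<and> i \<le> j \<longrightarrow> LR (\<ge>) L (\<theta> (i - 1)) (\<theta> i) (1 / \<alpha> i)) \<and>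
     (\<forall>i. j < i \<and> i < m \<longrightarrow> LR (\<le>) L (\<theta> (i - 1)) (\<theta> i) (\<beta> i))"

definition csprt_stop ::
  "nat \<Rightarrow> (nat \<Rightarrow> real) \<Rightarrow> (nat \<Rightarrow> real) \<Rightarrow> (nat \<Rightarrow> real) \<Rightarrow> (real \<Rightarrow> real) \<Rightarrow> bool" where
  "csprt_stop m \<theta> \<alpha> \<beta> L \<longleftrightarrow> (\<exists>j. csprt_index m \<theta> \<alpha> \<beta> L j)"

definition csprt_terminates_wp1 where
  "csprt_terminates_wp1 P \<Theta> N X f m \<theta> \<alpha> \<beta> \<longleftrightarrow>
     (\<forall>t\<in>\<Theta>. \<P>(\<omega> in P t. \<exists>n\<in>N. csprt_stop m \<theta> \<alpha> \<beta> (f n (obs X n \<omega>))) = 1)"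

text \<open>
  A policy selects an admissible index from the sample size and the observed data whenever there
  is one.  Measurability makes acceptance and rejection events; elsewhere its value is irrelevant.
\<close>

definition csprt_policy ::
  "nat set \<Rightarrow> (nat \<Rightarrow> (nat \<Rightarrow> 'a::euclidean_space) \<Rightarrow> real \<Rightarrow> real) \<Rightarrow> nat \<Rightarrow> (nat \<Rightarrow> real) \<Rightarrow>
   (nat \<Rightarrow> real) \<Rightarrow> (nat \<Rightarrow> real) \<Rightarrow> (nat \<Rightarrow> (nat \<Rightarrow> 'a) \<Rightarrow> nat) \<Rightarrow> bool" where
  "csprt_policy N f m \<theta> \<alpha> \<beta> d \<longleftrightarrow>
     (\<forall>n\<in>N. d n \<in> measurable (Pi\<^sub>M {1..n} (\<lambda>_. borel)) (count_space UNIV) \<and>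
        (\<forall>x\<in>{1..n} \<rightarrow>\<^sub>E UNIV.
           csprt_stop m \<theta> \<alpha> \<beta> (f n x) \<longrightarrow> csprt_index m \<theta> \<alpha> \<beta> (f n x) (d n x)))"

definition csprt_accepts where
  "csprt_accepts N X f m \<theta> \<alpha> \<beta> d j \<omega> \<longleftrightarrow>
     (\<exists>n\<in>N. csprt_stop m \<theta> \<alpha> \<beta> (f n (obs X n \<omega>)) \<and>
        (\<forall>k\<in>N. k < n \<longrightarrow> \<not> csprt_stop m \<theta> \<alpha> \<beta> (f k (obs X k \<omega>))) \<and>
        d n (obs X n \<omega>) = j)"

definition csprt_rejects where
  "csprt_rejects N X f m \<theta> \<alpha> \<beta> d i \<omega> \<longleftrightarrow>
     (\<exists>j. j \<noteq> i \<and> csprt_accepts N X f m \<theta> \<alpha> \<beta> d j \<omega>)"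

end

theory Submission
  imports Defs
begin

text \<open>
  Error bounds. Accepting an index \<open>j > i\<close> requires the likelihood of \<open>\<theta> i\<close> at the sample to be at
  most \<open>\<alpha> (i + 1)\<close> times that of \<open>\<theta> (i + 1)\<close>, and accepting an index \<open>j < i\<close> requires it to be at
  most \<open>\<beta> i\<close> times that of \<open>\<theta> (i - 1)\<close>. Integrating such a pointwise bound over the set of samples
  of size \<open>n\<close> at which the test first stops with such a \<open>j\<close>, the probability under \<open>\<theta> i\<close> is at most
  that factor times the probability under the neighbouring parameter
  (\<open>emeasure_obs_mono_likelihood\<close>). First stopping at different sample sizes gives disjoint events,
  so after summation over \<open>n\<close> the neighbour's total is at most \<open>1\<close>, and each of the two kinds of
  rejection has a probability of at most its factor (\<open>prob_disjoint_obs_le\<close>, \<open>prob_reject_le\<close>).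

  Termination. Fix a sample with unimodal likelihood at which no ratio of neighbours lies strictly
  between \<open>\<beta> i\<close> and \<open>1 / \<alpha> i\<close>: each step is a definite drop or a definite rise. As long as the
  likelihood is positive, a rise after a drop would contradict unimodality, so all rises come first
  and the index of the last one satisfies the stopping condition; steps from \<open>0\<close> to \<open>0\<close> count as
  both and do no harm (\<open>csprt_stop_if_decided\<close>). Hence the event of never stopping is contained, for
  every \<open>n\<close>, in the union over \<open>i\<close> of the events that the \<open>i\<close>-th ratio is undecided at \<open>n\<close>. The
  probabilities of these finitely many events tend to \<open>0\<close>
  (\<open>csprt_terminates_if_decided\<close>).
\<close>

\<comment> \<open>Keeps index ranges such as \<open>{1..n}\<close> in the form in which the definitions state them.\<close>
declare One_nat_def [simp del]

section \<open>Likelihood functions and change of parameter\<close>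

context parametric_process
begin

lemma space_P: "t \<in> \<Theta> \<Longrightarrow> space (P t) = space M"
  using sets_P by (rule sets_eq_imp_space_eq)

lemma measurable_P_cong: "t \<in> \<Theta> \<Longrightarrow> measurable (P t) K = measurable M K"
  using sets_P by (intro measurable_cong_sets) auto

lemma obs_measurable:
  assumes "n \<in> N"
  shows "obs X n \<in> measurable M (Pi\<^sub>M {1..n} (\<lambda>_. borel))"
  unfolding obs_def using X_measurable[OF assms] by (intro measurable_restrict) auto

lemma obs_in_PiE: "obs X n \<omega> \<in> {1..n} \<rightarrow>\<^sub>E UNIV"
  by (simp add: obs_def)

lemma restrict_obs: "k \<le> n \<Longrightarrow> restrict (obs X n \<omega>) {1..k} = obs X k \<omega>"
  by (auto simp: obs_def restrict_def)

lemma singleton_sets_PiM_borel: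
  fixes x :: "nat \<Rightarrow> 'a"
  assumes "x \<in> {1..n} \<rightarrow>\<^sub>E UNIV"
  shows "{x} \<in> sets (Pi\<^sub>M {1..n} (\<lambda>_. borel :: 'a measure))"
proof -
  have "{x} = (\<Pi>\<^sub>E k\<in>{1..n}. {x k})"
    using assms by (intro PiE_singleton[symmetric]) (simp add: PiE_def)
  then show ?thesis
    by (auto intro!: sets_PiM_I_finite)
qed

lemma likelihood_nonneg:
  assumes "n \<in> N" "t \<in> \<Theta>" "x \<in> {1..n} \<rightarrow>\<^sub>E UNIV"
  shows "0 \<le> f n x t"
  using joint_law[OF assms(1)] assms(2,3) by (auto simp: joint_pdf_def joint_pmf_def)

text \<open>
  The discrete counterpart of integrating a density. The countable set \<open>S\<close> carrying the law is a
  parameter of the formula, so that the laws under two parameters can be summed over one set.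
\<close>

lemma joint_pmf_emeasure:
  assumes n: "n \<in> N" and t: "t \<in> \<Theta>" and pmf: "joint_pmf (P t) X n (\<lambda>x. f n x t)"
    and S: "countable S" "S \<subseteq> {1..n} \<rightarrow>\<^sub>E UNIV" "AE \<omega> in P t. obs X n \<omega> \<in> S"
    and B: "B \<in> sets (Pi\<^sub>M {1..n} (\<lambda>_. borel))"
  shows "emeasure (P t) {\<omega> \<in> space M. obs X n \<omega> \<in> B}
    = (\<integral>\<^sup>+x. ennreal (f n x t) \<partial>count_space (B \<inter> S))"
proof -
  interpret prob_space "P t" using t by (rule prob_space_P)
  let ?K = "Pi\<^sub>M {1..n} (\<lambda>_. borel :: 'a measure)"
  have sing: "{x} \<in> sets ?K" if "x \<in> S" for x
    using that S(2) by (intro singleton_sets_PiM_borel) auto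
  have obs: "obs X n \<in> measurable (P t) ?K"
    unfolding measurable_P_cong[OF t] by (rule obs_measurable[OF n])
  have SK: "S \<in> sets ?K"
    using S(1) sing by (metis sets.countable)
  have distr: "emeasure (distr (P t) ?K (obs X n)) A = emeasure (P t) {\<omega> \<in> space M. obs X n \<omega> \<in> A}"
    if "A \<in> sets ?K" for A
    using that obs t by (simp add: emeasure_distr space_P vimage_def Int_def conj_commute)
  have "emeasure (P t) {\<omega> \<in> space M. obs X n \<omega> \<in> B} = emeasure (P t) {\<omega> \<in> space M. obs X n \<omega> \<in> B \<inter> S}"
  proof (rule emeasure_eq_AE)
    show "AE \<omega> in P t. (\<omega> \<in> {\<omega> \<in> space M. obs X n \<omega> \<in> B}) = (\<omega> \<in> {\<omega> \<in> space M. obs X n \<omega> \<in> B \<inter> S})"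
      using S(3) by eventually_elim auto
    show "{\<omega> \<in> space M. obs X n \<omega> \<in> B} \<in> events" "{\<omega> \<in> space M. obs X n \<omega> \<in> B \<inter> S} \<in> events"
      using measurable_sets[OF obs B] measurable_sets[OF obs sets.Int[OF B SK]]
      by (simp_all add: space_P[OF t] vimage_def Int_def conj_commute)
  qed
  also have "\<dots> = emeasure (distr (P t) ?K (obs X n)) (B \<inter> S)"
    using B SK by (intro distr[symmetric]) auto
  also have "\<dots> = (\<integral>\<^sup>+x. emeasure (distr (P t) ?K (obs X n)) {x} \<partial>count_space (B \<inter> S))"
    using S(1) sing by (intro emeasure_countable_singleton) auto
  also have "\<dots> = (\<integral>\<^sup>+x. ennreal (f n x t) \<partial>count_space (B \<inter> S))"
  proof (rule nn_integral_cong)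
    fix x assume "x \<in> space (count_space (B \<inter> S))"
    then have x: "x \<in> S" "x \<in> {1..n} \<rightarrow>\<^sub>E UNIV" using S(2) by auto
    then show "emeasure (distr (P t) ?K (obs X n)) {x} = ennreal (f n x t)"
      using pmf by (simp add: distr[OF sing[OF x(1)], simplified] joint_pmf_def emeasure_eq_measure space_P[OF t])
  qed
  finally show ?thesis .
qed

text \<open>
  In the discrete case the likelihood is measurable because it vanishes outside a countable set of
  samples.
\<close>

lemma likelihood_measurable:
  assumes n: "n \<in> N" and t: "t \<in> \<Theta>"
  shows "(\<lambda>x. f n x t) \<in> borel_measurable (Pi\<^sub>M {1..n} (\<lambda>_. borel))"
  using joint_law[OF n]
proof
  assume "\<forall>t\<in>\<Theta>. joint_pdf (P t) X n (\<lambda>x. f n x t)"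
  then have "(\<lambda>x. ennreal (f n x t)) \<in> borel_measurable (Pi\<^sub>M {1..n} (\<lambda>_. lborel))"
    using t by (auto simp: joint_pdf_def dest: distributed_borel_measurable)
  also have "borel_measurable (Pi\<^sub>M {1..n} (\<lambda>_. lborel)) = borel_measurable (Pi\<^sub>M {1..n} (\<lambda>_. borel :: 'a measure))"
    by (intro measurable_cong_sets sets_PiM_cong) auto
  finally have "(\<lambda>x. enn2real (ennreal (f n x t))) \<in> borel_measurable (Pi\<^sub>M {1..n} (\<lambda>_. borel))"
    by measurable
  then show ?thesis
    by (rule measurable_cong[THEN iffD1, rotated])
      (auto simp: space_PiM likelihood_nonneg[OF n t])
next
  assume "\<forall>t\<in>\<Theta>. joint_pmf (P t) X n (\<lambda>x. f n x t)"
  then have pmf: "joint_pmf (P t) X n (\<lambda>x. f n x t)" using t by auto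
  then obtain S where S: "countable S" "AE \<omega> in P t. obs X n \<omega> \<in> S"
    by (auto simp: joint_pmf_def)
  interpret prob_space "P t" using t by (rule prob_space_P)
  let ?E = "{1..n} \<rightarrow>\<^sub>E (UNIV :: 'a set)"
  let ?K = "Pi\<^sub>M {1..n} (\<lambda>_. borel :: 'a measure)"
  show ?thesis
  proof (rule measurable_discrete_difference[where X = "S \<inter> ?E" and f = "\<lambda>_. 0"])
    show "countable (S \<inter> ?E)" using S(1) by auto
    show "{x} \<in> sets ?K" if "x \<in> S \<inter> ?E" for x
      using that by (intro singleton_sets_PiM_borel) auto
    show "f n x t \<in> space borel" if "x \<in> S \<inter> ?E" for x by simp
    show "0 = f n x t" if x: "x \<in> space ?K" "x \<notin> S \<inter> ?E" for x
    proof -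
      from x have "x \<in> ?E" "x \<notin> S" by (auto simp: space_PiM)
      moreover have "prob {\<omega> \<in> space (P t). obs X n \<omega> = x} = 0"
        by (rule prob_eq_0_AE) (use S(2) \<open>x \<notin> S\<close> in \<open>auto elim: eventually_mono\<close>)
      ultimately show ?thesis using pmf by (auto simp: joint_pmf_def)
    qed
  qed simp
qed

text \<open>
  The likelihoods under two parameters are densities with respect to one common measure: Lebesgue
  measure, or counting measure on a countable set. A pointwise bound between them can therefore be
  integrated.
\<close>

lemma emeasure_obs_mono_likelihood:
  assumes n: "n \<in> N" and t: "t \<in> \<Theta>" "t' \<in> \<Theta>" and c: "0 \<le> c"
    and B: "B \<in> sets (Pi\<^sub>M {1..n} (\<lambda>_. borel))"
    and le: "\<And>x. x \<in> B \<Longrightarrow> f n x t \<le> c * f n x t'"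
  shows "emeasure (P t) {\<omega> \<in> space M. obs X n \<omega> \<in> B}
    \<le> ennreal c * emeasure (P t') {\<omega> \<in> space M. obs X n \<omega> \<in> B}"
proof -
  have le': "ennreal (f n x t) \<le> ennreal c * ennreal (f n x t')" if "x \<in> B" for x
    using le[OF that] c by (metis ennreal_leI ennreal_mult')
  show ?thesis
    using joint_law[OF n]
  proof
    assume pdf: "\<forall>t\<in>\<Theta>. joint_pdf (P t) X n (\<lambda>x. f n x t)"
    let ?L = "Pi\<^sub>M {1..n} (\<lambda>_. lborel :: 'a measure)"
    have "sets ?L = sets (Pi\<^sub>M {1..n} (\<lambda>_. borel :: 'a measure))"
      by (intro sets_PiM_cong) auto
    with B have BL: "B \<in> sets ?L" by simp
    have eq: "emeasure (P s) {\<omega> \<in> space M. obs X n \<omega> \<in> B} = (\<integral>\<^sup>+x. ennreal (f n x s) * indicator B x \<partial>?L)"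
      and meas: "(\<lambda>x. ennreal (f n x s)) \<in> borel_measurable ?L"
      if "s \<in> \<Theta>" for s
    proof -
      have D: "distributed (P s) ?L (obs X n) (\<lambda>x. ennreal (f n x s))"
        using pdf that by (auto simp: joint_pdf_def)
      show "(\<lambda>x. ennreal (f n x s)) \<in> borel_measurable ?L"
        using D by (rule distributed_borel_measurable)
      show "emeasure (P s) {\<omega> \<in> space M. obs X n \<omega> \<in> B} = (\<integral>\<^sup>+x. ennreal (f n x s) * indicator B x \<partial>?L)"
        using distributed_emeasure[OF D BL] that
        by (simp add: space_P vimage_def Int_def conj_commute)
    qed
    have "(\<integral>\<^sup>+x. ennreal (f n x t) * indicator B x \<partial>?L)
        \<le> (\<integral>\<^sup>+x. ennreal c * (ennreal (f n x t') * indicator B x) \<partial>?L)"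
      by (intro nn_integral_mono) (auto simp: indicator_def le')
    also have "\<dots> = ennreal c * (\<integral>\<^sup>+x. ennreal (f n x t') * indicator B x \<partial>?L)"
      using BL meas[OF t(2)]
      by (intro nn_integral_cmult borel_measurable_times_ennreal borel_measurable_indicator)
    finally show ?thesis by (simp add: eq t)
  next
    assume pmf: "\<forall>t\<in>\<Theta>. joint_pmf (P t) X n (\<lambda>x. f n x t)"
    obtain S S' where S: "countable S" "AE \<omega> in P t. obs X n \<omega> \<in> S"
        "countable S'" "AE \<omega> in P t'. obs X n \<omega> \<in> S'"
      using pmf t unfolding joint_pmf_def by metis
    \<comment> \<open>A common countable support turns both probabilities into sums over the same set.\<close>
    define T where "T = (S \<union> S') \<inter> ({1..n} \<rightarrow>\<^sub>E UNIV)"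
    have T: "countable T" "T \<subseteq> {1..n} \<rightarrow>\<^sub>E UNIV"
      "AE \<omega> in P t. obs X n \<omega> \<in> T" "AE \<omega> in P t'. obs X n \<omega> \<in> T"
      unfolding T_def using S by (auto simp: obs_in_PiE elim: eventually_mono)
    have "(\<integral>\<^sup>+x. ennreal (f n x t) \<partial>count_space (B \<inter> T))
        \<le> (\<integral>\<^sup>+x. ennreal c * ennreal (f n x t') \<partial>count_space (B \<inter> T))"
      by (intro nn_integral_mono) (auto simp: le')
    also have "\<dots> = ennreal c * (\<integral>\<^sup>+x. ennreal (f n x t') \<partial>count_space (B \<inter> T))"
      by (intro nn_integral_cmult) simp
    finally show ?thesis
      using pmf t by (simp add: joint_pmf_emeasure[OF n _ _ T(1,2) _ B] T(3,4))
  qed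
qed

text \<open>
  As the events are disjoint, their probabilities under \<open>t'\<close> sum to at most \<open>1\<close>, so
  infinitely many sample sizes cost no more than a single one.
\<close>

lemma prob_disjoint_obs_le:
  assumes t: "t \<in> \<Theta>" "t' \<in> \<Theta>" and c: "0 \<le> c"
    and B: "\<And>n. n \<in> N \<Longrightarrow> B n \<in> sets (Pi\<^sub>M {1..n} (\<lambda>_. borel))"
    and le: "\<And>n x. n \<in> N \<Longrightarrow> x \<in> B n \<Longrightarrow> f n x t \<le> c * f n x t'"
    and disj: "\<And>k n \<omega>. k \<in> N \<Longrightarrow> n \<in> N \<Longrightarrow> k < n \<Longrightarrow> obs X k \<omega> \<in> B k \<Longrightarrow> obs X n \<omega> \<notin> B n"
  shows "\<P>(\<omega> in P t. \<exists>n\<in>N. obs X n \<omega> \<in> B n) \<le> c"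
proof -
  interpret Pt: prob_space "P t" using t(1) by (rule prob_space_P)
  interpret Pt': prob_space "P t'" using t(2) by (rule prob_space_P)
  define A where "A n = (if n \<in> N then {\<omega> \<in> space M. obs X n \<omega> \<in> B n} else {})" for n
  have A_sets: "A n \<in> sets M" for n
    using measurable_sets[OF obs_measurable B, of n]
    by (simp add: A_def vimage_def Int_def conj_commute)
  then have A: "range A \<subseteq> sets (P s)" if "s \<in> \<Theta>" for s
    using that by (auto simp: sets_P)
  have A_disj: "disjoint_family A"
    unfolding disjoint_family_on_def A_def using disj by (auto split: if_splits) (metis linorder_neqE_nat)
  have "emeasure (P t) (\<Union>n. A n) = (\<Sum>n. emeasure (P t) (A n))"
    by (intro suminf_emeasure[symmetric] A A_disj t)
  also have "\<dots> \<le> (\<Sum>n. ennreal c * emeasure (P t') (A n))"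
    by (intro suminf_le) (auto simp: A_def intro!: emeasure_obs_mono_likelihood t c B le)
  also have "\<dots> = ennreal c * emeasure (P t') (\<Union>n. A n)"
    using suminf_emeasure[OF A A_disj] t by simp
  also have "\<dots> \<le> ennreal c * 1"
    by (intro mult_left_mono Pt'.emeasure_le_1) auto
  finally have "Pt.prob (\<Union>n. A n) \<le> c"
    using c by (simp add: Pt.emeasure_eq_measure)
  also have "(\<Union>n. A n) = {\<omega> \<in> space (P t). \<exists>n\<in>N. obs X n \<omega> \<in> B n}"
    by (auto simp: A_def space_P[OF t(1)] split: if_splits)
  finally show ?thesis .
qed

section \<open>Error probabilities of the test\<close>

lemma csprt_stop_measurable:
  assumes n: "n \<in> N" and \<theta>: "\<And>i. i < m \<Longrightarrow> \<theta> i \<in> \<Theta>"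
  shows "Measurable.pred (Pi\<^sub>M {1..n} (\<lambda>_. borel)) (\<lambda>x. csprt_stop m \<theta> \<alpha> \<beta> (f n x))"
proof -
  let ?Q = "\<lambda>x. \<exists>j\<in>{..<m}. (\<forall>i\<in>{0<..j}. inverse (\<alpha> i) * f n x (\<theta> (i - 1)) \<le> f n x (\<theta> i)) \<and>
    (\<forall>i\<in>{j<..<m}. f n x (\<theta> i) \<le> \<beta> i * f n x (\<theta> (i - 1)))"
  have "csprt_stop m \<theta> \<alpha> \<beta> (f n x) \<longleftrightarrow> ?Q x" for x
    unfolding csprt_stop_def csprt_index_def LR_def Bex_def Ball_def
    by (simp add: conj_assoc inverse_eq_divide)
  moreover have "Measurable.pred (Pi\<^sub>M {1..n} (\<lambda>_. borel)) ?Q"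
  proof -
    have meas: "(\<lambda>x. c * f n x (\<theta> k)) \<in> borel_measurable (Pi\<^sub>M {1..n} (\<lambda>_. borel))"
      if "k < m" for c k
      using likelihood_measurable[OF n \<theta>[OF that]] by measurable
    have "Measurable.pred (Pi\<^sub>M {1..n} (\<lambda>_. borel)) (\<lambda>x. c * f n x (\<theta> k) \<le> c' * f n x (\<theta> l))"
      if "k < m" "l < m" for c c' k l
      unfolding pred_def using that by (intro borel_measurable_le meas)
    from this[where c' = 1] this[where c = 1] show ?thesis
      by (intro pred_intros_finite pred_intros_logic) auto
  qed
  ultimately show ?thesis by simp
qed

text \<open>
  Not having stopped earlier is expressed through initial segments of the sample \<open>x\<close>. This makes
  the region a subset of the sample space, over which the likelihood can be integrated.
\<close>

definition first_stop_region where
  "first_stop_region m \<theta> \<alpha> \<beta> d J n = {x \<in> {1..n} \<rightarrow>\<^sub>E UNIV. csprt_stop m \<theta> \<alpha> \<beta> (f n x) \<and>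
     (\<forall>k\<in>N. k < n \<longrightarrow> \<not> csprt_stop m \<theta> \<alpha> \<beta> (f k (restrict x {1..k}))) \<and> d n x \<in> J}"

lemma obs_in_first_stop_region:
  "obs X n \<omega> \<in> first_stop_region m \<theta> \<alpha> \<beta> d J n \<longleftrightarrow>
     csprt_stop m \<theta> \<alpha> \<beta> (f n (obs X n \<omega>)) \<and>
     (\<forall>k\<in>N. k < n \<longrightarrow> \<not> csprt_stop m \<theta> \<alpha> \<beta> (f k (obs X k \<omega>))) \<and> d n (obs X n \<omega>) \<in> J"
  by (auto simp: first_stop_region_def restrict_obs obs_in_PiE)

lemma first_stop_region_sets:
  assumes n: "n \<in> N" and \<theta>: "\<And>i. i < m \<Longrightarrow> \<theta> i \<in> \<Theta>"
    and d: "csprt_policy N f m \<theta> \<alpha> \<beta> d"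
  shows "first_stop_region m \<theta> \<alpha> \<beta> d J n \<in> sets (Pi\<^sub>M {1..n} (\<lambda>_. borel))"
proof -
  let ?K = "\<lambda>k. Pi\<^sub>M {1..k} (\<lambda>_. borel :: 'a measure)"
  have [measurable]: "d n \<in> measurable (?K n) (count_space UNIV)"
    using d n by (auto simp: csprt_policy_def)
  note [measurable] = csprt_stop_measurable[OF n \<theta>]
  have earlier: "Measurable.pred (?K n) (\<lambda>x. \<not> csprt_stop m \<theta> \<alpha> \<beta> (f k (restrict x {1..k})))"
    if "k \<in> N" "k < n" for k
  proof -
    have "(\<lambda>x. restrict x {1..k}) \<in> measurable (?K n) (?K k)"
      using that by (intro measurable_restrict_subset) auto
    from measurable_compose[OF this csprt_stop_measurable[OF that(1) \<theta>]]
    show ?thesis by (rule pred_intros_logic)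
  qed
  have [measurable]: "Measurable.pred (?K n)
      (\<lambda>x. \<forall>k\<in>{k \<in> N. k < n}. \<not> csprt_stop m \<theta> \<alpha> \<beta> (f k (restrict x {1..k})))"
    using earlier by (intro pred_intros_finite) auto
  have "{x \<in> space (?K n). csprt_stop m \<theta> \<alpha> \<beta> (f n x) \<and>
     (\<forall>k\<in>{k \<in> N. k < n}. \<not> csprt_stop m \<theta> \<alpha> \<beta> (f k (restrict x {1..k}))) \<and> d n x \<in> J} \<in> sets (?K n)"
    by measurable
  also have "?this \<longleftrightarrow> ?thesis"
    by (intro arg_cong2[where f = "(\<in>)"]) (auto simp: first_stop_region_def space_PiM)
  finally show ?thesis .
qed

text \<open>
  If every \<open>L\<close> for which some index in \<open>J\<close> is admissible satisfies the same comparison between \<open>t\<close>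
  and \<open>t'\<close>, then the comparison holds on all regions of first stopping with a choice in \<open>J\<close>,
  whatever the policy.
\<close>

lemma prob_accept_le:
  assumes t: "t \<in> \<Theta>" "t' \<in> \<Theta>" and c: "0 \<le> c"
    and \<theta>: "\<And>i. i < m \<Longrightarrow> \<theta> i \<in> \<Theta>"
    and d: "csprt_policy N f m \<theta> \<alpha> \<beta> d"
    and le: "\<And>j L. j \<in> J \<Longrightarrow> csprt_index m \<theta> \<alpha> \<beta> L j \<Longrightarrow> L t \<le> c * L t'"
  shows "\<P>(\<omega> in P t. \<exists>n\<in>N. obs X n \<omega> \<in> first_stop_region m \<theta> \<alpha> \<beta> d J n) \<le> c"
proof (rule prob_disjoint_obs_le[OF t c])
  show "f n x t \<le> c * f n x t'" if "n \<in> N" "x \<in> first_stop_region m \<theta> \<alpha> \<beta> d J n" for n x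
  proof (rule le)
    show "d n x \<in> J" "csprt_index m \<theta> \<alpha> \<beta> (f n x) (d n x)"
      using that d by (auto simp: first_stop_region_def csprt_policy_def)
  qed
qed (auto simp: obs_in_first_stop_region intro!: first_stop_region_sets \<theta> d)

text \<open>
  Rejection splits into accepting a larger index, controlled by \<open>\<theta> (i + 1)\<close>, and accepting a smaller
  one, controlled by \<open>\<theta> (i - 1)\<close>.
\<close>

lemma prob_reject_le:
  assumes i: "i < m"
    and \<theta>: "\<And>i. i < m \<Longrightarrow> \<theta> i \<in> \<Theta>"
    and \<alpha>: "\<And>i. 0 < i \<Longrightarrow> i < m \<Longrightarrow> \<alpha> i \<in> {0<..<1}"
    and \<beta>: "\<And>i. 0 < i \<Longrightarrow> i < m \<Longrightarrow> \<beta> i \<in> {0<..<1}"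
    and ends: "\<alpha> m = 0" "\<beta> 0 = 0"
    and d: "csprt_policy N f m \<theta> \<alpha> \<beta> d"
  shows "\<P>(\<omega> in P (\<theta> i). csprt_rejects N X f m \<theta> \<alpha> \<beta> d i \<omega>) \<le> \<alpha> (i + 1) + \<beta> i"
proof -
  interpret prob_space "P (\<theta> i)" using \<theta>[OF i] by (rule prob_space_P)
  let ?R = "first_stop_region m \<theta> \<alpha> \<beta> d"
  let ?A = "\<lambda>J. {\<omega> \<in> space (P (\<theta> i)). \<exists>n\<in>N. obs X n \<omega> \<in> ?R J n}"
  have A_sets: "?A J \<in> events" for J
  proof -
    have "?A J = (\<Union>n\<in>N. obs X n -` ?R J n \<inter> space M)"
      by (auto simp: space_P[OF \<theta>[OF i]])
    also have "\<dots> \<in> sets M"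
      by (intro sets.countable_UN') (auto intro!: measurable_sets[OF obs_measurable] first_stop_region_sets \<theta> d)
    finally show ?thesis by (simp add: sets_P[OF \<theta>[OF i]])
  qed
  \<comment> \<open>For \<open>i + 1 = m\<close> there is no larger index to accept; the comparison is then vacuous and
    \<open>\<theta> i\<close> only serves as some element of \<open>\<Theta>\<close>. For \<open>i = 0\<close> the same happens below, where
    \<open>i - 1\<close> is \<open>0\<close>.\<close>
  have "prob (?A {i<..<m}) \<le> \<alpha> (i + 1)"
  proof (rule prob_accept_le[where t' = "\<theta> (if i + 1 < m then i + 1 else i)"])
    show "0 \<le> \<alpha> (i + 1)"
      using i \<alpha>[of "i + 1"] ends by (cases "i + 1 = m") auto
    show "L (\<theta> i) \<le> \<alpha> (i + 1) * L (\<theta> (if i + 1 < m then i + 1 else i))"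
      if "j \<in> {i<..<m}" "csprt_index m \<theta> \<alpha> \<beta> L j" for j L
    proof -
      from that have "1 / \<alpha> (i + 1) * L (\<theta> i) \<le> L (\<theta> (i + 1))"
        by (auto simp: csprt_index_def LR_def dest!: spec[of _ "i + 1"])
      moreover have "0 < \<alpha> (i + 1)" "i + 1 < m" using that \<alpha>[of "i + 1"] by auto
      ultimately show ?thesis by (simp add: field_simps)
    qed
  qed (use i \<theta> d in auto)
  moreover have "prob (?A {..<i}) \<le> \<beta> i"
  proof (rule prob_accept_le[where t' = "\<theta> (i - 1)"])
    show "0 \<le> \<beta> i"
      using i \<beta>[of i] ends by (cases "i = 0") auto
    show "L (\<theta> i) \<le> \<beta> i * L (\<theta> (i - 1))"
      if "j \<in> {..<i}" "csprt_index m \<theta> \<alpha> \<beta> L j" for j L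
      using that i by (auto simp: csprt_index_def LR_def)
  qed (use i \<theta> d in auto)
  moreover have "{\<omega> \<in> space (P (\<theta> i)). csprt_rejects N X f m \<theta> \<alpha> \<beta> d i \<omega>} \<subseteq> ?A {i<..<m} \<union> ?A {..<i}"
  proof safe
    fix \<omega>
    assume \<omega>: "\<omega> \<in> space (P (\<theta> i))" and rej: "csprt_rejects N X f m \<theta> \<alpha> \<beta> d i \<omega>"
      and no: "\<not> (\<exists>n\<in>N. obs X n \<omega> \<in> ?R {..<i} n)"
    from rej obtain n where n: "n \<in> N" "d n (obs X n \<omega>) \<noteq> i"
      and stop: "csprt_stop m \<theta> \<alpha> \<beta> (f n (obs X n \<omega>))"
      and first: "\<forall>k\<in>N. k < n \<longrightarrow> \<not> csprt_stop m \<theta> \<alpha> \<beta> (f k (obs X k \<omega>))"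
      by (auto simp: csprt_rejects_def csprt_accepts_def)
    have "d n (obs X n \<omega>) < m"
      using d n(1) stop obs_in_PiE by (auto simp: csprt_policy_def csprt_index_def)
    moreover have "\<not> d n (obs X n \<omega>) < i"
      using no n(1) stop first by (auto simp: obs_in_first_stop_region)
    ultimately show "\<exists>n\<in>N. obs X n \<omega> \<in> ?R {i<..<m} n"
      using n stop first by (intro bexI[of _ n]) (auto simp: obs_in_first_stop_region)
  qed
  then have "prob {\<omega> \<in> space (P (\<theta> i)). csprt_rejects N X f m \<theta> \<alpha> \<beta> d i \<omega>}
      \<le> prob (?A {i<..<m} \<union> ?A {..<i})"
    using A_sets by (intro finite_measure_mono) auto
  moreover have "prob (?A {i<..<m} \<union> ?A {..<i}) \<le> prob (?A {i<..<m}) + prob (?A {..<i})"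
    using A_sets by (intro measure_Un_le) auto
  ultimately show ?thesis by linarith
qed

end

section \<open>Termination of the test\<close>

text \<open>
  A definite rise at \<open>j\<close> forces the mode to lie above \<open>\<theta> (j - 1)\<close>, so the likelihood is
  non-decreasing up to there and no definite drop can precede \<open>j\<close>. If both neighbouring values
  vanish, the step counts as a rise and as a drop at once; this is why \<open>j\<close> is taken as the last
  place where the drop condition fails rather than the last where the rise condition holds.
\<close>

lemma csprt_stop_if_decided:
  assumes m: "0 < m" and \<theta>: "strict_mono_on {..<m} \<theta>" "\<And>i. i < m \<Longrightarrow> \<theta> i \<in> \<Theta>"
    and \<alpha>: "\<And>i. 0 < i \<Longrightarrow> i < m \<Longrightarrow> \<alpha> i \<in> {0<..<1}"
    and \<beta>: "\<And>i. 0 < i \<Longrightarrow> i < m \<Longrightarrow> \<beta> i \<in> {0<..<1}"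
    and L: "unimodal_on \<Theta> L" "\<And>i. i < m \<Longrightarrow> 0 \<le> L (\<theta> i)"
    and decided: "\<And>i. i \<in> {0<..<m} \<Longrightarrow>
      \<not> (LR (>) L (\<theta> (i - 1)) (\<theta> i) (\<beta> i) \<and> LR (<) L (\<theta> (i - 1)) (\<theta> i) (1 / \<alpha> i))"
  shows "csprt_stop m \<theta> \<alpha> \<beta> L"
proof -
  define U where "U = {i \<in> {0<..<m}. \<beta> i * L (\<theta> (i - 1)) < L (\<theta> i)}"
  define j where "j = Max (insert 0 U)"
  have "finite U" by (simp add: U_def)
  then have j_in: "j = 0 \<or> j \<in> U" and j_max: "\<And>i. i \<in> U \<Longrightarrow> i \<le> j"
    using Max_in[of "insert 0 U"] by (auto simp: j_def)
  have "j < m" using j_in m by (auto simp: U_def)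
  have up: "1 / \<alpha> i * L (\<theta> (i - 1)) \<le> L (\<theta> i)" if "i \<in> U" for i
    using decided[of i] that by (auto simp: U_def LR_def)
  have "1 / \<alpha> i * L (\<theta> (i - 1)) \<le> L (\<theta> i)" if i: "0 < i" "i < j" for i
  proof -
    from i j_in have jU: "j \<in> U" by auto
    then have j1: "0 < j" "j < m" by (auto simp: U_def)
    have nonneg: "0 \<le> L (\<theta> (j - 1))" "0 \<le> L (\<theta> (i - 1))" "0 \<le> L (\<theta> i)"
      using L(2) i \<open>j < m\<close> by auto
    have rise: "L (\<theta> (j - 1)) < L (\<theta> j)"
    proof (cases "L (\<theta> (j - 1)) = 0")
      case True
      then show ?thesis using jU by (auto simp: U_def)
    next
      case False
      then have "L (\<theta> (j - 1)) < 1 / \<alpha> j * L (\<theta> (j - 1))"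
        using nonneg(1) \<alpha>[OF j1] by (simp add: field_simps)
      then show ?thesis using up[OF jU] by linarith
    qed
    obtain c where c: "mono_on (\<Theta> \<inter> {..c}) L" "antimono_on (\<Theta> \<inter> {c..}) L"
      using L(1) by (auto simp: unimodal_on_def)
    have lt: "\<theta> a < \<theta> b" if "a < b" "b < m" for a b
      using \<theta>(1) that by (auto simp: strict_mono_on_def)
    have "\<theta> (j - 1) < c"
    proof (rule ccontr)
      assume "\<not> \<theta> (j - 1) < c"
      then have "L (\<theta> j) \<le> L (\<theta> (j - 1))"
        using lt[of "j - 1" j] j1 \<open>j < m\<close> \<theta>(2)
        by (intro monotone_onD[OF c(2)]) auto
      with rise show False by simp
    qed
    moreover have "\<theta> i \<le> \<theta> (j - 1)"
      using lt[of i "j - 1"] i \<open>j < m\<close> by (cases "i = j - 1") (simp, linarith)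
    ultimately have mono: "L (\<theta> (i - 1)) \<le> L (\<theta> i)"
      using lt[of "i - 1" i] i \<open>j < m\<close> \<theta>(2) by (intro mono_onD[OF c(1)]) auto
    show ?thesis
    proof (cases "i \<in> U")
      case False
      \<comment> \<open>A drop by the factor \<open>\<beta> i < 1\<close> on the rising side forces both values to vanish.\<close>
      then have "L (\<theta> i) \<le> \<beta> i * L (\<theta> (i - 1))"
        using i j1 by (auto simp: U_def)
      with mono have "(1 - \<beta> i) * L (\<theta> (i - 1)) \<le> 0"
        by (simp add: algebra_simps)
      moreover have "0 < 1 - \<beta> i" using \<beta>[of i] i j1 by auto
      ultimately have "L (\<theta> (i - 1)) = 0"
        using nonneg(2) by (simp add: mult_le_0_iff)
      then show ?thesis using nonneg(3) by simp
    qed (rule up)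
  qed
  moreover have "1 / \<alpha> j * L (\<theta> (j - 1)) \<le> L (\<theta> j)" if "0 < j"
    using that j_in up by auto
  moreover have "L (\<theta> i) \<le> \<beta> i * L (\<theta> (i - 1))" if "j < i" "i < m" for i
    using j_max[of i] that by (force simp: U_def not_less)
  ultimately have "csprt_index m \<theta> \<alpha> \<beta> L j"
    using \<open>j < m\<close> unfolding csprt_index_def LR_def by (metis le_neq_implies_less)
  then show ?thesis by (auto simp: csprt_stop_def)
qed

lemma tends_along_sum_zero:
  assumes "\<And>i. i \<in> I \<Longrightarrow> tends_along N (g i) 0"
  shows "tends_along N (\<lambda>n. \<Sum>i\<in>I. g i n) 0"
  using assms tendsto_sum[of I g "\<lambda>_. 0" "inf sequentially (principal N)"]
  by (auto simp: tends_along_def)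

text \<open>
  For infinite \<open>N\<close> this needs that the filter of \<open>n\<close> tending to infinity within \<open>N\<close> is proper.
\<close>

lemma tends_along_zero_lower_bound:
  assumes "N \<noteq> {}" "tends_along N g 0" "\<And>n. n \<in> N \<Longrightarrow> c \<le> g n"
  shows "c \<le> 0"
proof (cases "finite N")
  case True
  then have "Max N \<in> N" using assms(1) by (rule Max_in)
  from assms(3)[OF this] show ?thesis using assms(2) True by (simp add: tends_along_def)
next
  case False
  show ?thesis
  proof (rule tendsto_lowerbound)
    show "(g \<longlongrightarrow> 0) (inf sequentially (principal N))"
      using assms(2) False by (simp add: tends_along_def)
    show "eventually (\<lambda>n. c \<le> g n) (inf sequentially (principal N))"
      using assms(3) by (auto simp: eventually_inf_principal)
    have "frequently (\<lambda>n. n \<in> N) sequentially"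
      using False by (simp add: frequently_cofinite flip: cofinite_eq_sequentially)
    then show "inf sequentially (principal N) \<noteq> bot"
      by (auto simp: trivial_limit_def eventually_inf_principal frequently_def)
  qed
qed

context parametric_process
begin

text \<open>
  The event of never stopping does not depend on \<open>n\<close>, so it is enough that it is contained at each
  sample size in an event whose probability tends to \<open>0\<close>.
\<close>

lemma csprt_terminates_if_decided:
  assumes m: "0 < m" and \<theta>: "strict_mono_on {..<m} \<theta>" "\<And>i. i < m \<Longrightarrow> \<theta> i \<in> \<Theta>"
    and \<alpha>: "\<And>i. 0 < i \<Longrightarrow> i < m \<Longrightarrow> \<alpha> i \<in> {0<..<1}"
    and \<beta>: "\<And>i. 0 < i \<Longrightarrow> i < m \<Longrightarrow> \<beta> i \<in> {0<..<1}"
    and unimodal: "\<And>n \<omega>. n \<in> N \<Longrightarrow> \<omega> \<in> space M \<Longrightarrow> unimodal_on \<Theta> (f n (obs X n \<omega>))"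
    and undecided: "\<And>t i. t \<in> \<Theta> \<Longrightarrow> i \<in> {0<..<m} \<Longrightarrow>
      tends_along N (\<lambda>n. \<P>(\<omega> in P t. LR (>) (f n (obs X n \<omega>)) (\<theta> (i - 1)) (\<theta> i) (\<beta> i) \<and>
        LR (<) (f n (obs X n \<omega>)) (\<theta> (i - 1)) (\<theta> i) (1 / \<alpha> i))) 0"
  shows "csprt_terminates_wp1 P \<Theta> N X f m \<theta> \<alpha> \<beta>"
  unfolding csprt_terminates_wp1_def
proof
  fix t assume t: "t \<in> \<Theta>"
  interpret prob_space "P t" using t by (rule prob_space_P)
  note sp = space_P[OF t] and st = sets_P[OF t]
  let ?stop = "\<lambda>n \<omega>. csprt_stop m \<theta> \<alpha> \<beta> (f n (obs X n \<omega>))"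
  let ?undec = "\<lambda>i n. {\<omega> \<in> space (P t). LR (>) (f n (obs X n \<omega>)) (\<theta> (i - 1)) (\<theta> i) (\<beta> i) \<and>
        LR (<) (f n (obs X n \<omega>)) (\<theta> (i - 1)) (\<theta> i) (1 / \<alpha> i)}"
  let ?never = "{\<omega> \<in> space (P t). \<not> (\<exists>n\<in>N. ?stop n \<omega>)}"
  have "prob ?never \<le> (\<Sum>i\<in>{0<..<m}. prob (?undec i n))" if n: "n \<in> N" for n
  proof -
    have undec_sets: "?undec i n \<in> events" if "i \<in> {0<..<m}" for i
    proof -
      have [measurable]: "(\<lambda>\<omega>. f n (obs X n \<omega>) (\<theta> k)) \<in> borel_measurable M" if "k < m" for k
        by (rule measurable_compose[OF obs_measurable[OF n] likelihood_measurable[OF n \<theta>(2)[OF that]]])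
      have [measurable]: "(\<lambda>\<omega>. f n (obs X n \<omega>) (\<theta> i)) \<in> borel_measurable M"
        "(\<lambda>\<omega>. f n (obs X n \<omega>) (\<theta> (i - 1))) \<in> borel_measurable M"
        using that by auto
      show ?thesis unfolding LR_def sp st by measurable
    qed
    have "?never \<subseteq> (\<Union>i\<in>{0<..<m}. ?undec i n)"
    proof
      fix \<omega> assume \<omega>: "\<omega> \<in> ?never"
      show "\<omega> \<in> (\<Union>i\<in>{0<..<m}. ?undec i n)"
      proof (rule ccontr)
        assume "\<omega> \<notin> (\<Union>i\<in>{0<..<m}. ?undec i n)"
        with \<omega> have "?stop n \<omega>"
          by (intro csprt_stop_if_decided[OF m \<theta> \<alpha> \<beta>] unimodal n likelihood_nonneg \<theta>(2) obs_in_PiE)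
            (auto simp: sp)
        with \<omega> n show False by auto
      qed
    qed
    then have "prob ?never \<le> prob (\<Union>i\<in>{0<..<m}. ?undec i n)"
      using undec_sets by (intro finite_measure_mono) auto
    also have "\<dots> \<le> (\<Sum>i\<in>{0<..<m}. prob (?undec i n))"
      using undec_sets by (intro finite_measure_subadditive_finite) auto
    finally show ?thesis .
  qed
  moreover have "tends_along N (\<lambda>n. \<Sum>i\<in>{0<..<m}. prob (?undec i n)) 0"
    using undecided t by (intro tends_along_sum_zero) auto
  ultimately have "prob ?never \<le> 0"
    using N_nonempty by (intro tends_along_zero_lower_bound)
  then have never: "prob ?never = 0"
    by (simp add: measure_le_0_iff)
  have "{\<omega> \<in> space M. \<exists>n\<in>N. ?stop n \<omega>} = (\<Union>n\<in>N. {\<omega> \<in> space M. ?stop n \<omega>})"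
    by auto
  also have "\<dots> \<in> sets M"
    using measurable_compose[OF obs_measurable csprt_stop_measurable[OF _ \<theta>(2)]]
    by (intro sets.countable_UN') (auto simp: pred_def)
  finally have "{\<omega> \<in> space (P t). \<exists>n\<in>N. ?stop n \<omega>} \<in> events"
    by (simp add: sp st)
  from prob_neg[OF this] never show "prob {\<omega> \<in> space (P t). \<exists>n\<in>N. ?stop n \<omega>} = 1"
    by simp
qed

end

theorem theorem4:
  fixes M :: "'w measure"
    and P :: "real \<Rightarrow> 'w measure"
    and \<Theta> :: "real set"
    and N :: "nat set"
    and X :: "nat \<Rightarrow> 'w \<Rightarrow> 'a::euclidean_space"
    and f :: "nat \<Rightarrow> (nat \<Rightarrow> 'a) \<Rightarrow> real \<Rightarrow> real"
    and m :: nat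
    and \<theta> \<alpha> \<beta> :: "nat \<Rightarrow> real"
    and d :: "nat \<Rightarrow> (nat \<Rightarrow> 'a) \<Rightarrow> nat"
  assumes "parametric_process M P \<Theta> N X f"
    and "2 \<le> m"
    and "strict_mono_on {..<m} \<theta>"
    and "\<And>i. i < m \<Longrightarrow> \<theta> i \<in> \<Theta>"
    and "\<And>i. 1 \<le> i \<Longrightarrow> i \<le> m - 1 \<Longrightarrow> \<alpha> i \<in> {0<..<1}"
    and "\<And>i. 1 \<le> i \<Longrightarrow> i \<le> m - 1 \<Longrightarrow> \<beta> i \<in> {0<..<1}"
    and "\<alpha> m = 0" and "\<beta> 0 = 0"
    and "csprt_policy N f m \<theta> \<alpha> \<beta> d"
  shows "(csprt_terminates_wp1 P \<Theta> N X f m \<theta> \<alpha> \<beta> \<longrightarrow>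
           (\<forall>i\<le>m - 1. \<P>(\<omega> in P (\<theta> i). csprt_rejects N X f m \<theta> \<alpha> \<beta> d i \<omega>) \<le> \<alpha> (i + 1) + \<beta> i))
       \<and> ((\<forall>n\<in>N. \<forall>\<omega>\<in>space M. unimodal_on \<Theta> (f n (obs X n \<omega>))) \<and>
           (\<forall>a\<in>{0<..<1}. \<forall>b\<in>{0<..<1}. \<forall>t\<in>\<Theta>. \<forall>i\<in>{1..m - 1}.
              tends_along N
                (\<lambda>n. \<P>(\<omega> in P t. LR (>) (f n (obs X n \<omega>)) (\<theta> (i - 1)) (\<theta> i) b \<and>
                                  LR (<) (f n (obs X n \<omega>)) (\<theta> (i - 1)) (\<theta> i) (1 / a))) 0)
         \<longrightarrow> csprt_terminates_wp1 P \<Theta> N X f m \<theta> \<alpha> \<beta>)"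
proof (intro conjI impI allI)
  fix i assume "i \<le> m - 1"
  with assms(2) have "i < m" by simp
  then show "\<P>(\<omega> in P (\<theta> i). csprt_rejects N X f m \<theta> \<alpha> \<beta> d i \<omega>) \<le> \<alpha> (i + 1) + \<beta> i"
    by (rule parametric_process.prob_reject_le[OF assms(1)])
      (use assms in auto)
next
  assume *: "(\<forall>n\<in>N. \<forall>\<omega>\<in>space M. unimodal_on \<Theta> (f n (obs X n \<omega>))) \<and>
    (\<forall>a\<in>{0<..<1}. \<forall>b\<in>{0<..<1}. \<forall>t\<in>\<Theta>. \<forall>i\<in>{1..m - 1}.
      tends_along N
        (\<lambda>n. \<P>(\<omega> in P t. LR (>) (f n (obs X n \<omega>)) (\<theta> (i - 1)) (\<theta> i) b \<and>
                          LR (<) (f n (obs X n \<omega>)) (\<theta> (i - 1)) (\<theta> i) (1 / a))) 0)"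
  show "csprt_terminates_wp1 P \<Theta> N X f m \<theta> \<alpha> \<beta>"
    using assms(2,5,6) *
    by (intro parametric_process.csprt_terminates_if_decided[OF assms(1) _ assms(3,4)]) auto
qed

end
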